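(* Assume the following conditions. (a) The sets $G$ and $R$ are both standard in $T$: there exist constants $C>0$ and $\varepsilon_0>0$ such that for all $\varepsilon\in(0,\varepsilon_0]$ and all $t\in T$, $$P_X(B(t,\varepsilon))\ge C\,\mu(B(t,\varepsilon))\quad\text{and}\quad P_Y(B(t,\varepsilon))\ge C\,\mu(B(t,\varepsilon)).$$ (b) The sequence $\{\varepsilon_n\}$ of positive numbers satisfies $\varepsilon_n\to 0$ and $\dfrac{n\varepsilon_n^d}{\log n}\to\infty$ as $n\to\infty$. Then $$L_n=\frac{\mu(T_n)}{2\varepsilon_n}\to L_0\quad\text{almost surely.}$$
   Context: $\mu$ is Lebesgue measure on $\mathbb{R}^d$ and $\|\cdot\|$ the Euclidean norm; $B(x,\varepsilon)$ is the closed ball with center $x$ and radius $\varepsilon$, and for $A\subset\mathbb{R}^d$, $B(A,\varepsilon)=\bigcup_{x\in A}B(x,\varepsilon)$. $G\subset(0,1)^d$ is a body (a compact set with $\mu(G)>0$), $R=[0,1]^d\setminus G$, and $T=\partial G$ is the boundary of $G$. The Minkowski content $$L_0=L_0(G)=\lim_{\varepsilon\to0^+}\frac{\mu(B(T,\varepsilon))}{2\varepsilon}$$ is assumed to exist, to be finite and to be strictly positive. Sampling model: $(Z_1,\delta_1),(Z_2,\delta_2),\ldots$ are i.i.d. copies of $(Z,\delta)$, where $Z$ is uniformly distributed on $[0,1]^d$, $\delta=1$ if $Z\in G$ and $\delta=0$ if $Z\notin G$. $P_X$ and $P_Y$ denote the conditional distributions of $Z$ given $\delta=1$ and given $\delta=0$,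 i.e. the uniform distributions on $G$ and $R$ respectively. For $z\in[0,1]^d$ and $\varepsilon\ge0$, let $G_z(\varepsilon)=\#\{i\le n:\delta_i=1,\ \|Z_i-z\|\le\varepsilon\}$ and $R_z(\varepsilon)=\#\{i\le n:\delta_i=0,\ \|Z_i-z\|\le\varepsilon\}$ (both depend on $n$). For a deterministic sequence $\{\varepsilon_n\}$ of positive numbers, define $$T_n=\{z\in[0,1]^d: R_z(\varepsilon_n)\ge1\text{ and }G_z(\varepsilon_n)\ge1\},\qquad L_n=\frac{\mu(T_n)}{2\varepsilon_n}.$$ *)

theory Defs
  imports "HOL-Probability.Probability"
begin

definition body :: "(real ^ 'd) set \<Rightarrow> bool"
  where "body G \<longleftrightarrow> compact G \<and> measure lborel G > 0"

definition unit_cube :: "(real ^ 'd) set"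
  where "unit_cube = cbox 0 1"

definition outer :: "(real ^ 'd) set \<Rightarrow> (real ^ 'd) set"
  where "outer G = unit_cube - G"

definition parallel_set :: "(real ^ 'd) set \<Rightarrow> real \<Rightarrow> (real ^ 'd) set"
  where "parallel_set A e = (\<Union>x\<in>A. cball x e)"

text \<open>
  Existence and finiteness of the Minkowski content are part of this relation, as the limit
  is taken in the reals; for bounded \<open>G\<close> the measures involved are finite.
\<close>

definition has_minkowski_content :: "(real ^ 'd) set \<Rightarrow> real \<Rightarrow> bool"
  where "has_minkowski_content G L \<longleftrightarrow>
    ((\<lambda>e. measure lborel (parallel_set (frontier G) e) / (2 * e)) \<longlongrightarrow> L) (at_right 0)"

definition standard_in ::
    "(real ^ 'd) measure \<Rightarrow> (real ^ 'd) set \<Rightarrow> real \<Rightarrow> real \<Rightarrow> bool"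
  where "standard_in P S C e0 \<longleftrightarrow>
    (\<forall>e t. 0 < e \<and> e \<le> e0 \<and> t \<in> S \<longrightarrow> measure P (cball t e) \<ge> C * measure lborel (cball t e))"

text \<open>
  The sample points are indexed from 1. The labels are random variables of their own: a pair
  \<open>(Z i, \<delta> i)\<close> only shares its law with \<open>(z, indicator G z)\<close>, \<open>z\<close> uniform on the cube, so that
  \<open>\<delta> i\<close> is the membership indicator of \<open>Z i\<close> almost surely.
\<close>

definition labelled_sample ::
    "'w measure \<Rightarrow> (real ^ 'd) set \<Rightarrow> (nat \<Rightarrow> 'w \<Rightarrow> real ^ 'd) \<Rightarrow> (nat \<Rightarrow> 'w \<Rightarrow> nat) \<Rightarrow> bool"
  where "labelled_sample M G Z \<delta> \<longleftrightarrow>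
    prob_space.indep_vars M (\<lambda>_. borel \<Otimes>\<^sub>M count_space UNIV) (\<lambda>i \<omega>. (Z i \<omega>, \<delta> i \<omega>)) {1..} \<and>
    (\<forall>i\<ge>1. distr M (borel \<Otimes>\<^sub>M count_space UNIV) (\<lambda>\<omega>. (Z i \<omega>, \<delta> i \<omega>)) =
       distr (uniform_measure lborel unit_cube) (borel \<Otimes>\<^sub>M count_space UNIV)
         (\<lambda>z. (z, if z \<in> G then 1 else 0)))"

definition label_count ::
    "(nat \<Rightarrow> real ^ 'd) \<Rightarrow> (nat \<Rightarrow> nat) \<Rightarrow> nat \<Rightarrow> nat \<Rightarrow> real ^ 'd \<Rightarrow> real \<Rightarrow> nat"
  where "label_count z\<^sub>s d\<^sub>s l n z e = card {i \<in> {1..n}. d\<^sub>s i = l \<and> norm (z\<^sub>s i - z) \<le> e}"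

definition boundary_estimate ::
    "(nat \<Rightarrow> real ^ 'd) \<Rightarrow> (nat \<Rightarrow> nat) \<Rightarrow> nat \<Rightarrow> real \<Rightarrow> (real ^ 'd) set"
  where "boundary_estimate z\<^sub>s d\<^sub>s n e =
    {z \<in> unit_cube. label_count z\<^sub>s d\<^sub>s 0 n z e \<ge> 1 \<and> label_count z\<^sub>s d\<^sub>s 1 n z e \<ge> 1}"

definition content_estimate ::
    "(nat \<Rightarrow> real ^ 'd) \<Rightarrow> (nat \<Rightarrow> nat) \<Rightarrow> nat \<Rightarrow> real \<Rightarrow> real"
  where "content_estimate z\<^sub>s d\<^sub>s n e = measure lborel (boundary_estimate z\<^sub>s d\<^sub>s n e) / (2 * e)"

end

theory Submission
  imports Defs
begin

text \<open>
  Both inequalities of the limit come from inclusions between the random set \<open>T\<^sub>n\<close> and parallel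
  sets of the boundary \<open>T\<close>. A ball that meets both \<open>G\<close> and its complement meets \<open>T\<close>, because
  balls are connected; hence \<open>T\<^sub>n \<subseteq> B(T,\<epsilon>\<^sub>n)\<close> as soon as every label says truthfully whether its
  point lies in \<open>G\<close>, which is almost sure (\<open>boundary_estimate_subset_parallel_set\<close>,
  \<open>AE_labels_truthful\<close>).

  Conversely, fix \<open>0 < \<eta> < 1\<close>. If every ball \<open>B(t,\<eta>\<epsilon>\<^sub>n)\<close>, \<open>t \<in> T\<close>, contains sample points with
  both labels, then a ball of radius \<open>\<epsilon>\<^sub>n\<close> around any point of \<open>B(T,(1-\<eta>)\<epsilon>\<^sub>n)\<close> contains such a
  smaller ball, so \<open>B(T,(1-\<eta>)\<epsilon>\<^sub>n) \<subseteq> T\<^sub>n\<close> (\<open>parallel_set_subset_boundary_estimate\<close>). The balls are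
  hit simultaneously, almost surely for all large \<open>n\<close>: \<open>T\<close> is covered by \<open>O(\<epsilon>\<^sub>n\<^sup>-\<^sup>d)\<close> balls of
  radius \<open>\<eta>\<epsilon>\<^sub>n/2\<close>, standardness bounds the probability that one of them is missed by
  \<open>(1 - \<kappa>\<epsilon>\<^sub>n\<^sup>d)\<^sup>n \<le> exp (-\<kappa>n\<epsilon>\<^sub>n\<^sup>d)\<close>, and since \<open>n\<epsilon>\<^sub>n\<^sup>d / log n \<rightarrow> \<infinity>\<close> the union bound is eventually below a
  multiple of \<open>n\<^sup>-\<^sup>2\<close>, so that the Borel--Cantelli lemma applies (\<open>AE_eventually_balls_hit\<close>).

  Dividing by \<open>2\<epsilon>\<^sub>n\<close>, the estimate is squeezed between sequences that tend to \<open>(1-\<eta>)L\<^sub>0\<close> and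
  \<open>L\<^sub>0\<close>; letting \<open>\<eta>\<close> run through a sequence that tends to \<open>0\<close> gives the theorem.
\<close>

section \<open>The estimate and the parallel sets of the boundary\<close>

lemma label_count_ge_1_iff:
  "label_count zs ds l n z e \<ge> 1 \<longleftrightarrow> (\<exists>i\<in>{1..n}. ds i = l \<and> norm (zs i - z) \<le> e)"
proof -
  have "finite {i \<in> {1..n}. ds i = l \<and> norm (zs i - z) \<le> e}"
    by simp
  then have "label_count zs ds l n z e \<ge> 1 \<longleftrightarrow> {i \<in> {1..n}. ds i = l \<and> norm (zs i - z) \<le> e} \<noteq> {}"
    unfolding label_count_def by (simp add: Suc_le_eq card_gt_0_iff)
  then show ?thesis
    by blast
qed

lemma compact_parallel_set:
  "compact A \<Longrightarrow> compact (parallel_set A e)"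
  unfolding parallel_set_def by (rule compact_minkowski_sum_cball)

lemma compact_boundary_estimate: "compact (boundary_estimate zs ds n e)"
proof -
  let ?U = "\<lambda>l. \<Union>i\<in>{i \<in> {1..n}. ds i = l}. cball (zs i) e"
  have "boundary_estimate zs ds n e = unit_cube \<inter> (?U 0 \<inter> ?U 1)"
    unfolding boundary_estimate_def label_count_ge_1_iff by (auto simp: dist_norm)
  moreover have "compact (?U l)" for l
    by (intro compact_UN) auto
  ultimately show ?thesis
    unfolding unit_cube_def by (simp add: compact_Int)
qed

lemma boundary_estimate_subset_parallel_set:
  assumes "\<And>i. i \<ge> 1 \<Longrightarrow> ds i = (if zs i \<in> G then 1 else 0)"
  shows "boundary_estimate zs ds n e \<subseteq> parallel_set (frontier G) e"
proof
  fix z assume "z \<in> boundary_estimate zs ds n e"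
  then obtain i j where ij: "i \<in> {1..n}" "ds i = 0" "norm (zs i - z) \<le> e"
      "j \<in> {1..n}" "ds j = 1" "norm (zs j - z) \<le> e"
    unfolding boundary_estimate_def label_count_ge_1_iff by blast
  have "zs i \<notin> G"
    using assms[of i] ij(1,2) by (cases "zs i \<in> G") simp_all
  moreover have "zs j \<in> G"
    using assms[of j] ij(4,5) by (cases "zs j \<in> G") simp_all
  moreover have "zs i \<in> cball z e" "zs j \<in> cball z e"
    using ij(3,6) by (simp_all add: dist_norm norm_minus_commute)
  ultimately have "cball z e \<inter> frontier G \<noteq> {}"
    by (intro connected_Int_frontier) auto
  then show "z \<in> parallel_set (frontier G) e"
    unfolding parallel_set_def by (auto simp: dist_commute)
qed

lemma parallel_set_subset_boundary_estimate:
  assumes cube: "parallel_set T ((1 - \<eta>) * e) \<subseteq> unit_cube"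
    and hit: "\<And>t l. t \<in> T \<Longrightarrow> l \<in> {0, 1} \<Longrightarrow> \<exists>i\<in>{1..n}. ds i = l \<and> norm (zs i - t) \<le> \<eta> * e"
  shows "parallel_set T ((1 - \<eta>) * e) \<subseteq> boundary_estimate zs ds n e"
proof
  fix z assume z: "z \<in> parallel_set T ((1 - \<eta>) * e)"
  then obtain t where t: "t \<in> T" "norm (t - z) \<le> (1 - \<eta>) * e"
    unfolding parallel_set_def by (auto simp: dist_norm)
  have "label_count zs ds l n z e \<ge> 1" if l: "l \<in> {0, 1}" for l
  proof -
    obtain i where i: "i \<in> {1..n}" "ds i = l" "norm (zs i - t) \<le> \<eta> * e"
      using hit[OF t(1) l] by blast
    have "norm (zs i - z) \<le> norm (zs i - t) + norm (t - z)"
      using norm_triangle_ineq[of "zs i - t" "t - z"] by simp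
    also have "\<dots> \<le> e"
      using i(3) t(2) by (simp add: algebra_simps)
    finally show ?thesis
      unfolding label_count_ge_1_iff using i by blast
  qed
  then show "z \<in> boundary_estimate zs ds n e"
    unfolding boundary_estimate_def using z cube by auto
qed

section \<open>Covering numbers and standardness\<close>

text \<open>
  Cutting the cube into cells of side \<open>r/d\<close> makes two points of the same cell at most \<open>r\<close> apart,
  so one point of \<open>T\<close> from each cell that meets \<open>T\<close> suffices. The centres have to lie in \<open>T\<close>
  itself because standardness speaks only of balls centred there.
\<close>

lemma cover_by_balls_centred_in_set:
  fixes T :: "(real ^ 'd) set"
  assumes T: "T \<subseteq> unit_cube" and r: "0 < r" "r \<le> 1"
  obtains F where "finite F" "F \<subseteq> T" "T \<subseteq> (\<Union>x\<in>F. cball x r)"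
    "real (card F) \<le> ((real CARD('d) + 1) / r) ^ CARD('d)"
proof -
  define m where "m = nat \<lfloor>real CARD('d) / r\<rfloor>"
  define cell where "cell x = (\<lambda>i::'d. nat \<lfloor>x $ i * (real CARD('d) / r)\<rfloor>)" for x :: "real ^ 'd"
  have Q: "real CARD('d) / r > 0"
    using r by simp
  have coord: "0 \<le> x $ i" "x $ i \<le> 1" if "x \<in> T" for x i
    using that T by (auto simp: unit_cube_def mem_box_cart)
  have cells: "cell ` T \<subseteq> UNIV \<rightarrow>\<^sub>E {0..m}"
  proof -
    have "x $ i * (real CARD('d) / r) \<le> real CARD('d) / r" if "x \<in> T" for x i
      using mult_right_mono[OF coord(2)[OF that, of i], of "real CARD('d) / r"] Q by simp
    then show ?thesis
      unfolding cell_def m_def by (auto intro!: nat_mono floor_mono simp: PiE_UNIV_domain)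
  qed
  have fin: "finite (UNIV \<rightarrow>\<^sub>E {0..m} :: ('d \<Rightarrow> nat) set)"
    by (intro finite_PiE) auto
  have card_cells: "card (cell ` T) \<le> (m + 1) ^ CARD('d)"
    using card_mono[OF fin cells] by (simp add: card_PiE)
  define F where "F = inv_into T cell ` (cell ` T)"
  have "finite F"
    unfolding F_def using finite_subset[OF cells fin] by simp
  moreover have "F \<subseteq> T"
    unfolding F_def using inv_into_into[of _ cell T] by blast
  moreover have "T \<subseteq> (\<Union>x\<in>F. cball x r)"
  proof
    fix x assume x: "x \<in> T"
    define y where "y = inv_into T cell (cell x)"
    have y: "y \<in> F" "y \<in> T" "cell y = cell x"
      unfolding y_def F_def using x by (auto simp: inv_into_into f_inv_into_f)
    \<comment> \<open>The coordinates are nonnegative, so truncation to natural numbers does not merge cells.\<close>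
    have "\<bar>(y - x) $ i\<bar> \<le> r / real CARD('d)" for i
    proof -
      let ?a = "x $ i * (real CARD('d) / r)" and ?b = "y $ i * (real CARD('d) / r)"
      have nonneg: "0 \<le> ?a" "0 \<le> ?b"
        using coord(1)[OF x, of i] coord(1)[OF y(2), of i] Q
        by (intro mult_nonneg_nonneg; simp)+
      have "nat \<lfloor>?a\<rfloor> = nat \<lfloor>?b\<rfloor>"
        using fun_cong[OF y(3), of i] by (simp add: cell_def)
      then have "\<lfloor>?a\<rfloor> = \<lfloor>?b\<rfloor>"
        using nonneg by (metis floor_mono floor_zero nat_0_le)
      then have "\<bar>?b - ?a\<bar> \<le> 1"
        by linarith
      also have "?b - ?a = (y - x) $ i * (real CARD('d) / r)"
        by (simp add: left_diff_distrib diff_divide_distrib)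
      finally have "\<bar>(y - x) $ i\<bar> * (real CARD('d) / r) \<le> 1"
        by (simp only: abs_mult abs_of_pos[OF Q])
      then have "\<bar>(y - x) $ i\<bar> \<le> 1 / (real CARD('d) / r)"
        by (simp only: pos_le_divide_eq[OF Q])
      then show ?thesis
        by simp
    qed
    then have "(\<Sum>i\<in>UNIV. \<bar>(y - x) $ i\<bar>) \<le> r"
      using sum_bounded_above[of UNIV "\<lambda>i. \<bar>(y - x) $ i\<bar>" "r / real CARD('d)"] by simp
    then have "norm (y - x) \<le> r"
      using norm_le_l1_cart[of "y - x"] by linarith
    then show "x \<in> (\<Union>x\<in>F. cball x r)"
      using y(1) by (auto simp: dist_norm)
  qed
  moreover have "real (card F) \<le> ((real CARD('d) + 1) / r) ^ CARD('d)"
  proof -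
    have "card F \<le> (m + 1) ^ CARD('d)"
      unfolding F_def using card_image_le[of "cell ` T" "inv_into T cell"] card_cells
        finite_subset[OF cells fin] by linarith
    then have "real (card F) \<le> real ((m + 1) ^ CARD('d))"
      by (rule of_nat_mono)
    also have "\<dots> = (real m + 1) ^ CARD('d)"
      by (simp add: add.commute)
    also have "\<dots> \<le> ((real CARD('d) + 1) / r) ^ CARD('d)"
    proof (rule power_mono)
      have "real m \<le> real CARD('d) / r"
        unfolding m_def using Q by simp
      moreover have "1 \<le> 1 / r"
        using r by simp
      ultimately show "real m + 1 \<le> (real CARD('d) + 1) / r"
        by (simp add: add_divide_distrib)
    qed simp
    finally show ?thesis .
  qed
  ultimately show thesis
    by (rule that)
qed

text \<open>
  If \<open>S\<close> is a null set, then the uniform measure on it is the zero measure, which is standard only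
  in the empty set; otherwise the volume of \<open>S\<close> becomes a factor of \<open>\<kappa>\<close>, together with \<open>C\<close> and the
  volume of the unit ball.
\<close>

lemma standard_in_uniform_measure_mass:
  fixes S T :: "(real ^ 'd) set"
  assumes std: "standard_in (uniform_measure lborel S) T C e0"
    and C: "C > 0" and S: "S \<in> sets borel" "S \<subseteq> unit_cube"
  shows "\<exists>\<kappa>>0. \<forall>t\<in>T. \<forall>r. 0 < r \<and> r \<le> e0 \<longrightarrow> \<kappa> * r ^ CARD('d) \<le> measure lborel (S \<inter> cball t r)"
proof -
  have fin: "emeasure lborel S < \<infinity>"
    using emeasure_mono[of S "cbox 0 1" lborel] S emeasure_lborel_cbox_finite[of 0 1]
    unfolding unit_cube_def by (auto intro: le_less_trans)
  show ?thesis
  proof (cases "measure lborel S = 0")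
    case True
    then have null: "emeasure lborel S = 0"
      using fin by (simp add: emeasure_eq_ennreal_measure)
    have "emeasure lborel (S \<inter> cball t r) = 0" for t r
      using null emeasure_mono[of "S \<inter> cball t r" S lborel] S by simp
    then have "measure (uniform_measure lborel S) (cball t r) = 0" for t r
      using S by (simp add: measure_def)
    moreover have "C * measure lborel (cball t r) > 0" if "r > 0" for t :: "real ^ 'd" and r
      using C content_cball_pos[OF that] by simp
    ultimately have "\<not> (0 < r \<and> r \<le> e0 \<and> t \<in> T)" for t r
      using std unfolding standard_in_def by (metis linorder_not_less)
    then show ?thesis
      by (intro exI[of _ 1]) auto
  next
    case False
    have pos: "measure lborel S > 0"
      using False by (simp add: zero_less_measure_iff)
    define \<kappa> where "\<kappa> = C * measure lborel S * unit_ball_vol (real CARD('d))"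
    have "\<kappa> > 0"
      unfolding \<kappa>_def using C pos by simp
    moreover have "\<kappa> * r ^ CARD('d) \<le> measure lborel (S \<inter> cball t r)"
      if "t \<in> T" "0 < r" "r \<le> e0" for t r
    proof -
      have "C * measure lborel (cball t r) \<le> measure (uniform_measure lborel S) (cball t r)"
        using std that unfolding standard_in_def by blast
      also have "\<dots> = measure lborel (S \<inter> cball t r) / measure lborel S"
        using S fin False by (intro measure_uniform_measure) (auto simp: measure_def)
      finally have "C * measure lborel (cball t r) * measure lborel S \<le> measure lborel (S \<inter> cball t r)"
        using pos by (simp add: field_simps)
      then show ?thesis
        using that unfolding \<kappa>_def by (simp add: content_cball mult_ac)
    qed
    ultimately show ?thesis
      by blast
  qed
qed

section \<open>Hitting the balls around the boundary\<close>

definition labelled_region :: "(real ^ 'd) set \<Rightarrow> nat \<Rightarrow> (real ^ 'd) set"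
  where "labelled_region G l = {z \<in> unit_cube. (if z \<in> G then 1 else 0) = l}"

lemma labelled_region_1: "G \<subseteq> unit_cube \<Longrightarrow> labelled_region G 1 = G"
  unfolding labelled_region_def by auto

lemma labelled_region_0: "labelled_region G 0 = outer G"
  unfolding labelled_region_def outer_def by auto

lemma measurable_true_label:
  fixes G :: "(real ^ 'd) set"
  assumes "G \<in> sets borel"
  shows "(\<lambda>z. (z, if z \<in> G then 1 else 0 :: nat))
    \<in> measurable (uniform_measure lborel unit_cube) (borel \<Otimes>\<^sub>M count_space UNIV)"
  using assms by measurable

lemma labelled_sample_measurable:
  assumes "prob_space M" "labelled_sample M G Z \<delta>" "i \<ge> 1"
  shows "(\<lambda>\<omega>. (Z i \<omega>, \<delta> i \<omega>)) \<in> measurable M (borel \<Otimes>\<^sub>M count_space UNIV)"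
  using assms unfolding labelled_sample_def by (auto simp: prob_space.indep_vars_def)

lemma AE_labels_truthful:
  assumes M: "prob_space M" and sample: "labelled_sample M G Z \<delta>" and G: "G \<in> sets borel"
  shows "AE \<omega> in M. \<forall>i\<ge>1. \<delta> i \<omega> = (if Z i \<omega> \<in> G then 1 else 0)"
proof -
  let ?N = "borel \<Otimes>\<^sub>M count_space UNIV :: ((real ^ 'd) \<times> nat) measure"
  have "{x \<in> space ?N. snd x = (if fst x \<in> G then 1 else 0)} = G \<times> {1} \<union> (- G) \<times> {0}"
    by (auto simp: space_pair_measure split: if_splits)
  also have "\<dots> \<in> sets ?N"
    using G by (intro sets.Un pair_measureI) auto
  finally have truthful: "{x \<in> space ?N. snd x = (if fst x \<in> G then 1 else 0)} \<in> sets ?N" .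
  have "AE \<omega> in M. \<delta> i \<omega> = (if Z i \<omega> \<in> G then 1 else 0)" if i: "i \<ge> 1" for i
  proof -
    have "AE x in distr (uniform_measure lborel unit_cube) ?N (\<lambda>z. (z, if z \<in> G then 1 else 0)).
        snd x = (if fst x \<in> G then 1 else 0)"
      by (subst AE_distr_iff[OF measurable_true_label[OF G] truthful]) simp
    also have "distr (uniform_measure lborel unit_cube) ?N (\<lambda>z. (z, if z \<in> G then 1 else 0)) =
        distr M ?N (\<lambda>\<omega>. (Z i \<omega>, \<delta> i \<omega>))"
      using sample i unfolding labelled_sample_def by simp
    finally have "AE x in distr M ?N (\<lambda>\<omega>. (Z i \<omega>, \<delta> i \<omega>)). snd x = (if fst x \<in> G then 1 else 0)" .
    then show ?thesis
      by (subst (asm) AE_distr_iff[OF labelled_sample_measurable[OF M sample i] truthful]) simp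
  qed
  then show ?thesis
    by (simp add: AE_all_countable)
qed

lemma prob_sample_in_ball:
  fixes G :: "(real ^ 'd) set"
  assumes M: "prob_space M" and sample: "labelled_sample M G Z \<delta>" and G: "G \<in> sets borel"
    and i: "i \<ge> 1"
  shows "measure M ((\<lambda>\<omega>. (Z i \<omega>, \<delta> i \<omega>)) -` (cball t r \<times> {l}) \<inter> space M) =
    measure lborel (labelled_region G l \<inter> cball t r)"
proof -
  let ?N = "borel \<Otimes>\<^sub>M count_space UNIV :: ((real ^ 'd) \<times> nat) measure"
  let ?U = "uniform_measure lborel unit_cube :: (real ^ 'd) measure"
  let ?f = "\<lambda>z. (z, if z \<in> G then 1 else 0 :: nat)"
  have A: "cball t r \<times> {l} \<in> sets ?N"
    by (intro pair_measureI) auto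
  have cube: "emeasure lborel (unit_cube :: (real ^ 'd) set) = 1"
    using content_cbox_cart[of 0 "1 :: real ^ 'd"] emeasure_lborel_cbox_finite[of 0 "1 :: real ^ 'd"]
    unfolding unit_cube_def by (simp add: emeasure_eq_ennreal_measure interval_ne_empty_cart)
  have "measure M ((\<lambda>\<omega>. (Z i \<omega>, \<delta> i \<omega>)) -` (cball t r \<times> {l}) \<inter> space M) =
      measure (distr M ?N (\<lambda>\<omega>. (Z i \<omega>, \<delta> i \<omega>))) (cball t r \<times> {l})"
    by (rule measure_distr[symmetric, OF labelled_sample_measurable[OF M sample i] A])
  also have "\<dots> = measure (distr ?U ?N ?f) (cball t r \<times> {l})"
    using sample i unfolding labelled_sample_def by simp
  also have "\<dots> = measure ?U (?f -` (cball t r \<times> {l}) \<inter> space ?U)"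
    by (rule measure_distr[OF measurable_true_label[OF G] A])
  also have "\<dots> = measure lborel (unit_cube \<inter> (?f -` (cball t r \<times> {l}) \<inter> space ?U)) /
      measure lborel (unit_cube :: (real ^ 'd) set)"
    using measurable_sets[OF measurable_true_label[OF G] A] cube
    by (intro measure_uniform_measure) auto
  also have "measure lborel (unit_cube :: (real ^ 'd) set) = 1"
    using cube by (simp add: measure_def)
  also have "unit_cube \<inter> (?f -` (cball t r \<times> {l}) \<inter> space ?U) = labelled_region G l \<inter> cball t r"
    unfolding labelled_region_def by auto
  finally show ?thesis
    by simp
qed

text \<open>
  By independence the probability that all \<open>n\<close> points miss is an \<open>n\<close>-th power, and
  \<open>1 - p \<le> exp (- p)\<close>; the exponential form is what gets compared with powers of \<open>n\<close> later.
\<close>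

lemma prob_ball_missed_le:
  fixes G :: "(real ^ 'd) set"
  assumes M: "prob_space M" and sample: "labelled_sample M G Z \<delta>" and G: "G \<in> sets borel"
    and n: "n \<ge> 1" and p: "p \<le> measure lborel (labelled_region G l \<inter> cball t r)"
  shows "{\<omega> \<in> space M. \<forall>i\<in>{1..n}. \<not> (Z i \<omega> \<in> cball t r \<and> \<delta> i \<omega> = l)} \<in> sets M" (is "?A \<in> _")
    and "measure M {\<omega> \<in> space M. \<forall>i\<in>{1..n}. \<not> (Z i \<omega> \<in> cball t r \<and> \<delta> i \<omega> = l)} \<le> exp (- (real n * p))"
proof -
  interpret prob_space M by (rule M)
  let ?N = "borel \<Otimes>\<^sub>M count_space UNIV :: ((real ^ 'd) \<times> nat) measure"
  let ?W = "\<lambda>i \<omega>. (Z i \<omega>, \<delta> i \<omega>)" and ?S = "cball t r \<times> {l}"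
  have S: "?S \<in> sets ?N"
    by (intro pair_measureI) auto
  then have S': "- ?S \<in> sets ?N"
    using sets.compl_sets[OF S] by (simp add: space_pair_measure Compl_eq_Diff_UNIV)
  have A: "?A = (\<Inter>i\<in>{1..n}. ?W i -` (- ?S) \<inter> space M)"
    using n by auto
  show "?A \<in> sets M"
    unfolding A using n
    by (intro sets.finite_INT measurable_sets[OF labelled_sample_measurable[OF M sample] S']) auto
  have "indep_vars (\<lambda>_. ?N) ?W {1..}"
    using sample unfolding labelled_sample_def by blast
  then have "prob ?A = (\<Prod>i\<in>{1..n}. prob (?W i -` (- ?S) \<inter> space M))"
    unfolding A using n S' by (intro indep_varsD) auto
  also have "\<dots> \<le> (\<Prod>i\<in>{1..n}. exp (- p))"
  proof (rule prod_mono, safe)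
    fix i assume i: "i \<in> {1..n}"
    then have i1: "i \<ge> 1" by simp
    have "?W i -` (- ?S) \<inter> space M = space M - (?W i -` ?S \<inter> space M)"
      by auto
    then have "prob (?W i -` (- ?S) \<inter> space M) = 1 - prob (?W i -` ?S \<inter> space M)"
      using prob_compl[OF measurable_sets[OF labelled_sample_measurable[OF M sample i1] S]] by simp
    also have "\<dots> \<le> 1 - p"
      using p prob_sample_in_ball[OF M sample G i1] by simp
    also have "\<dots> \<le> exp (- p)"
      using exp_ge_add_one_self[of "- p"] by simp
    finally show "prob (?W i -` (- ?S) \<inter> space M) \<le> exp (- p)" .
  qed simp
  also have "\<dots> = exp (- (real n * p))"
    by (simp add: exp_of_nat_mult[symmetric])
  finally show "prob ?A \<le> exp (- (real n * p))" .
qed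

text \<open>
  In the union bound, the number of balls in the cover is a multiple of \<open>\<epsilon>\<^sub>n\<^sup>-\<^sup>d\<close> and hence
  eventually \<open>O(n)\<close>, while \<open>n\<epsilon>\<^sub>n\<^sup>d\<close> eventually exceeds any given multiple of \<open>log n\<close>.
\<close>

lemma union_bound_eventually_le:
  fixes \<epsilon> :: "nat \<Rightarrow> real"
  assumes lim: "filterlim (\<lambda>n. real n * \<epsilon> n ^ d / ln (real n)) at_top sequentially"
    and c: "c > 0" and pos: "\<And>n. n \<ge> 1 \<Longrightarrow> \<epsilon> n > 0"
  shows "eventually (\<lambda>n. exp (- (real n * (c * \<epsilon> n ^ d))) / \<epsilon> n ^ d \<le> 1 / real n ^ 2) sequentially"
proof -
  \<comment> \<open>The bound \<open>1\<close> gives \<open>1 / \<epsilon>\<^sub>n\<^sup>d \<le> n\<close>, the bound \<open>3 / c\<close> makes the exponential at most \<open>n\<^sup>-\<^sup>3\<close>.\<close>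
  have "eventually (\<lambda>n. max 1 (3 / c) \<le> real n * \<epsilon> n ^ d / ln (real n)) sequentially"
    using lim unfolding filterlim_at_top by blast
  then show ?thesis
    using eventually_ge_at_top[of 3]
  proof eventually_elim
    case (elim n)
    have n: "real n > 0"
      using elim by simp
    have ln: "ln (real n) \<ge> 1"
    proof -
      have "exp 1 \<le> real n"
        using exp_le elim(2) by linarith
      then show ?thesis
        using n by (simp add: ln_ge_iff)
    qed
    have e: "\<epsilon> n ^ d > 0"
      using pos[of n] elim by simp
    have "1 * ln (real n) \<le> real n * \<epsilon> n ^ d"
      using elim ln by (simp add: pos_le_divide_eq)
    then have "1 \<le> real n * \<epsilon> n ^ d"
      using ln by linarith
    then have inv: "1 / \<epsilon> n ^ d \<le> real n"
      using e by (simp add: field_simps)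
    have "3 / c * ln (real n) \<le> real n * \<epsilon> n ^ d"
      using elim ln by (simp add: pos_le_divide_eq)
    then have "3 * ln (real n) \<le> real n * (c * \<epsilon> n ^ d)"
      using c by (simp add: field_simps)
    then have "exp (- (real n * (c * \<epsilon> n ^ d))) \<le> exp (- (3 * ln (real n)))"
      by simp
    also have "\<dots> = 1 / real n ^ 3"
      using n exp_of_nat_mult[of 3 "ln (real n)"] by (simp add: exp_minus field_simps)
    finally have "exp (- (real n * (c * \<epsilon> n ^ d))) * (1 / \<epsilon> n ^ d) \<le> 1 / real n ^ 3 * real n"
      using inv e by (intro mult_mono) auto
    then show ?case
      using n by (simp add: power3_eq_cube power2_eq_square)
  qed
qed

text \<open>
  The uncountable family of events ``the ball around \<open>t\<close> is missed'' is reduced to finitely many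
  by halving the radius: a ball of radius \<open>\<eta>\<epsilon>\<^sub>n/2\<close> around a centre of the cover that is at most
  \<open>\<eta>\<epsilon>\<^sub>n/2\<close> away from \<open>t\<close> lies in the ball of radius \<open>\<eta>\<epsilon>\<^sub>n\<close> around \<open>t\<close>, so a sample point in the
  former also serves \<open>t\<close>. The finite union is also an event, which the union over all of \<open>T\<close> need not be a priori.
\<close>

lemma AE_eventually_balls_hit:
  fixes G T :: "(real ^ 'd) set"
  assumes M: "prob_space M" and sample: "labelled_sample M G Z \<delta>" and G: "G \<in> sets borel"
    and T: "T \<subseteq> unit_cube"
    and \<kappa>: "\<kappa> > 0" and e0: "e0 > 0"
    and mass: "\<And>t r. t \<in> T \<Longrightarrow> 0 < r \<Longrightarrow> r \<le> e0 \<Longrightarrow>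
      \<kappa> * r ^ CARD('d) \<le> measure lborel (labelled_region G l \<inter> cball t r)"
    and \<eta>: "\<eta> > 0"
    and pos: "\<And>n. n \<ge> 1 \<Longrightarrow> \<epsilon> n > 0"
    and null: "\<epsilon> \<longlonglongrightarrow> 0"
    and lim: "filterlim (\<lambda>n. real n * \<epsilon> n ^ CARD('d) / ln (real n)) at_top sequentially"
  shows "AE \<omega> in M. eventually (\<lambda>n. \<forall>t\<in>T. \<exists>i\<in>{1..n}. \<delta> i \<omega> = l \<and> norm (Z i \<omega> - t) \<le> \<eta> * \<epsilon> n)
    sequentially"
proof -
  interpret prob_space M by (rule M)
  define r where "r n = \<eta> * \<epsilon> n / 2" for n
  define good where "good n \<longleftrightarrow> n \<ge> 1 \<and> r n \<le> 1 \<and> r n \<le> e0" for n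
  have r_pos: "r n > 0" if "n \<ge> 1" for n
    unfolding r_def using \<eta> pos[OF that] by simp
  have r_lim: "r \<longlonglongrightarrow> 0"
    unfolding r_def using tendsto_mult_left[OF null, of "\<eta> / 2"] by simp
  have ev_good: "eventually good sequentially"
    using order_tendstoD(2)[OF r_lim zero_less_one] order_tendstoD(2)[OF r_lim e0]
      eventually_ge_at_top[of 1]
    by eventually_elim (simp add: good_def)
  have "\<exists>F. good n \<longrightarrow> finite F \<and> F \<subseteq> T \<and> T \<subseteq> (\<Union>x\<in>F. cball x (r n)) \<and>
      real (card F) \<le> ((real CARD('d) + 1) / r n) ^ CARD('d)" for n
    using cover_by_balls_centred_in_set[OF T, of "r n"] r_pos[of n] unfolding good_def by metis
  then obtain F where F: "\<And>n. good n \<Longrightarrow> finite (F n) \<and> F n \<subseteq> T \<and> T \<subseteq> (\<Union>x\<in>F n. cball x (r n)) \<and>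
      real (card (F n)) \<le> ((real CARD('d) + 1) / r n) ^ CARD('d)"
    by metis
  define miss where
    "miss n t = {\<omega> \<in> space M. \<forall>i\<in>{1..n}. \<not> (Z i \<omega> \<in> cball t (r n) \<and> \<delta> i \<omega> = l)}" for n t
  \<comment> \<open>Where no cover is available, the default is the empty event; this concerns finitely many \<open>n\<close>.\<close>
  define bad where "bad n = (if good n then \<Union>t\<in>F n. miss n t else {})" for n
  have miss_bound: "miss n t \<in> sets M"
      "prob (miss n t) \<le> exp (- (real n * (\<kappa> * r n ^ CARD('d))))"
    if "good n" "t \<in> F n" for n t
    using that F[OF that(1)] r_pos[of n] mass[of t "r n"]
      prob_ball_missed_le[OF M sample G, of n "\<kappa> * r n ^ CARD('d)" l t "r n"]
    unfolding miss_def good_def by auto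
  have bad_meas: "bad n \<in> sets M" for n
    unfolding bad_def using F[of n] miss_bound(1)[of n] by auto
  define K where "K = (2 * (real CARD('d) + 1) / \<eta>) ^ CARD('d)"
  define c where "c = \<kappa> * (\<eta> / 2) ^ CARD('d)"
  have "c > 0"
    unfolding c_def using \<kappa> \<eta> by simp
  have "eventually (\<lambda>n. exp (- (real n * (c * \<epsilon> n ^ CARD('d)))) / \<epsilon> n ^ CARD('d)
      \<le> 1 / real n ^ 2) sequentially"
    by (rule union_bound_eventually_le[OF lim \<open>c > 0\<close>]) (rule pos)
  with ev_good have "eventually (\<lambda>n. prob (bad n) \<le> K * (1 / real n ^ 2)) sequentially"
  proof eventually_elim
    case (elim n)
    have "prob (bad n) \<le> (\<Sum>t\<in>F n. prob (miss n t))"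
      unfolding bad_def using elim(1) F[OF elim(1)] miss_bound(1)[OF elim(1)]
      by (auto intro!: finite_measure_subadditive_finite)
    also have "\<dots> \<le> real (card (F n)) * exp (- (real n * (\<kappa> * r n ^ CARD('d))))"
      using miss_bound(2)[OF elim(1)] by (intro sum_bounded_above)
    also have "\<dots> \<le> ((real CARD('d) + 1) / r n) ^ CARD('d) * exp (- (real n * (\<kappa> * r n ^ CARD('d))))"
      using F[OF elim(1)] by (intro mult_right_mono) auto
    also have "((real CARD('d) + 1) / r n) ^ CARD('d) = K / \<epsilon> n ^ CARD('d)"
      unfolding K_def r_def by (simp add: power_divide power_mult_distrib mult.commute)
    also have "\<kappa> * r n ^ CARD('d) = c * \<epsilon> n ^ CARD('d)"
      unfolding c_def r_def by (simp add: power_divide power_mult_distrib)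
    finally have "prob (bad n) \<le> K * (exp (- (real n * (c * \<epsilon> n ^ CARD('d)))) / \<epsilon> n ^ CARD('d))"
      by simp
    also have "\<dots> \<le> K * (1 / real n ^ 2)"
      unfolding K_def using elim(2) \<eta> by (intro mult_left_mono) auto
    finally show ?case .
  qed
  then have "eventually (\<lambda>n. norm (prob (bad n)) \<le> K * (1 / real n ^ 2)) sequentially"
    by simp
  moreover have "summable (\<lambda>n. K * (1 / real n ^ 2))"
    using inverse_power_summable[of 2, where ?'a = real]
    by (intro summable_mult) (simp add: inverse_eq_divide)
  ultimately have "summable (\<lambda>n. prob (bad n))"
    by (rule summable_comparison_test_ev)
  then have "AE \<omega> in M. eventually (\<lambda>n. \<omega> \<in> space M - bad n) sequentially"
    using bad_meas by (intro borel_cantelli_AE1) (auto simp: less_top[symmetric])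
  then show ?thesis
  proof eventually_elim
    case (elim \<omega>)
    from elim ev_good show ?case
    proof eventually_elim
      case (elim n)
      show ?case
      proof
        fix t assume "t \<in> T"
        then obtain s where s: "s \<in> F n" "dist s t \<le> r n"
          using F[OF elim(2)] by auto
        then obtain i where i: "i \<in> {1..n}" "Z i \<omega> \<in> cball s (r n)" "\<delta> i \<omega> = l"
          using elim unfolding bad_def miss_def by auto
        have "dist (Z i \<omega>) t \<le> dist s (Z i \<omega>) + dist s t"
          by (rule dist_triangle3)
        also have "\<dots> \<le> \<eta> * \<epsilon> n"
          using i(2) s(2) unfolding r_def by simp
        finally show "\<exists>i\<in>{1..n}. \<delta> i \<omega> = l \<and> norm (Z i \<omega> - t) \<le> \<eta> * \<epsilon> n"
          using i by (auto simp: dist_norm)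
      qed
    qed
  qed
qed

section \<open>Consistency of the estimate\<close>

text \<open>
  This is the limiting argument with the randomness removed: hypotheses \<open>upper\<close> and \<open>lower\<close> are
  what almost every sample satisfies. Only countably many \<open>\<eta>\<close> are asked for, so that the
  exceptional null sets can be united.
\<close>

lemma content_estimate_tendsto:
  fixes G :: "(real ^ 'd) set"
  assumes compact: "compact (frontier G)"
    and content: "has_minkowski_content G L0"
    and pos: "\<And>n. n \<ge> 1 \<Longrightarrow> \<epsilon> n > 0" and null: "\<epsilon> \<longlonglongrightarrow> 0"
    and upper: "\<And>n. boundary_estimate zs ds n (\<epsilon> n) \<subseteq> parallel_set (frontier G) (\<epsilon> n)"
    and lower: "\<And>k. eventually (\<lambda>n. parallel_set (frontier G) ((1 - 1 / real (k + 2)) * \<epsilon> n)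
      \<subseteq> boundary_estimate zs ds n (\<epsilon> n)) sequentially"
  shows "(\<lambda>n. content_estimate zs ds n (\<epsilon> n)) \<longlonglongrightarrow> L0"
proof -
  define V where "V e = measure lborel (parallel_set (frontier G) e) / (2 * e)" for e
  have V_lim: "(\<lambda>n. V (\<theta> * \<epsilon> n)) \<longlonglongrightarrow> L0" if "\<theta> > 0" for \<theta>
  proof -
    have "eventually (\<lambda>n. \<theta> * \<epsilon> n > 0) sequentially"
      using that pos by (intro eventually_sequentiallyI[of 1]) simp
    then have "filterlim (\<lambda>n. \<theta> * \<epsilon> n) (at_right 0) sequentially"
      using tendsto_mult_left[OF null, of \<theta>] tendsto_imp_filterlim_at_right by fastforce
    moreover have "(V \<longlongrightarrow> L0) (at_right 0)"
      using content unfolding has_minkowski_content_def V_def .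
    ultimately show ?thesis
      by (rule filterlim_compose[rotated])
  qed
  have meas_mono: "measure lborel A \<le> measure lborel B" if "A \<subseteq> B" "compact A" "compact B"
    for A B :: "(real ^ 'd) set"
    using that by (intro measure_mono_fmeasurable) (auto simp: fmeasurable_compact borel_compact)
  note cpt = compact_parallel_set[OF compact] compact_boundary_estimate
  have above: "eventually (\<lambda>n. content_estimate zs ds n (\<epsilon> n) \<le> V (1 * \<epsilon> n)) sequentially"
    using eventually_ge_at_top[of 1]
  proof eventually_elim
    case (elim n)
    then show ?case
      unfolding content_estimate_def V_def using pos[OF elim] meas_mono[OF upper cpt(2,1)]
      by (auto intro!: divide_right_mono)
  qed
  have below: "eventually (\<lambda>n. \<theta> * V (\<theta> * \<epsilon> n) \<le> content_estimate zs ds n (\<epsilon> n)) sequentially"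
    if \<theta>: "\<theta> = 1 - 1 / real (k + 2)" for \<theta> k
    using eventually_ge_at_top[of 1] lower[of k, folded \<theta>]
  proof eventually_elim
    case (elim n)
    have "\<theta> > 0"
      unfolding \<theta> by simp
    then have "\<theta> * V (\<theta> * \<epsilon> n) = measure lborel (parallel_set (frontier G) (\<theta> * \<epsilon> n)) / (2 * \<epsilon> n)"
      unfolding V_def by simp
    also have "\<dots> \<le> content_estimate zs ds n (\<epsilon> n)"
      unfolding content_estimate_def using pos[OF elim(1)] meas_mono[OF elim(2) cpt]
      by (auto intro!: divide_right_mono)
    finally show ?case .
  qed
  show ?thesis
  proof (rule order_tendstoI)
    fix a assume "L0 < a"
    then have "eventually (\<lambda>n. V (1 * \<epsilon> n) < a) sequentially"
      by (intro order_tendstoD(2)[OF V_lim]) auto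
    with above show "eventually (\<lambda>n. content_estimate zs ds n (\<epsilon> n) < a) sequentially"
      by eventually_elim simp
  next
    fix a assume "a < L0"
    have "(\<lambda>k. (1 - 1 / real (k + 2)) * L0) \<longlonglongrightarrow> (1 - 0) * L0"
      by (intro tendsto_intros LIMSEQ_ignore_initial_segment[OF lim_1_over_n])
    then have "eventually (\<lambda>k. a < (1 - 1 / real (k + 2)) * L0) sequentially"
      using \<open>a < L0\<close> by (intro order_tendstoD(1)) auto
    then obtain k where k: "a < (1 - 1 / real (k + 2)) * L0"
      unfolding eventually_sequentially by blast
    define \<theta> where "\<theta> = 1 - 1 / real (k + 2)"
    have "\<theta> > 0"
      unfolding \<theta>_def by simp
    then have "(\<lambda>n. \<theta> * V (\<theta> * \<epsilon> n)) \<longlonglongrightarrow> \<theta> * L0"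
      by (intro tendsto_mult_left V_lim)
    then have "eventually (\<lambda>n. a < \<theta> * V (\<theta> * \<epsilon> n)) sequentially"
      using k unfolding \<theta>_def[symmetric] by (rule order_tendstoD(1))
    with below[OF \<theta>_def] show "eventually (\<lambda>n. a < content_estimate zs ds n (\<epsilon> n)) sequentially"
      by eventually_elim simp
  qed
qed

theorem theorem1:
  fixes G :: "(real ^ 'd) set" and L0 :: real
    and M :: "'w measure"
    and Z :: "nat \<Rightarrow> 'w \<Rightarrow> real ^ 'd" and \<delta> :: "nat \<Rightarrow> 'w \<Rightarrow> nat"
    and \<epsilon> :: "nat \<Rightarrow> real"
  assumes "body G" and "G \<subseteq> box 0 1"
    and "has_minkowski_content G L0" and "L0 > 0"
    and "prob_space M" and "labelled_sample M G Z \<delta>"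
    and "\<exists>C>0. \<exists>\<epsilon>\<^sub>0>0.
           standard_in (uniform_measure lborel G) (frontier G) C \<epsilon>\<^sub>0 \<and>
           standard_in (uniform_measure lborel (outer G)) (frontier G) C \<epsilon>\<^sub>0"
    and "\<And>n. n \<ge> 1 \<Longrightarrow> \<epsilon> n > 0"
    and "\<epsilon> \<longlonglongrightarrow> 0"
    and "filterlim (\<lambda>n. real n * \<epsilon> n ^ CARD('d) / ln (real n)) at_top sequentially"
  shows "AE \<omega> in M.
    (\<lambda>n. content_estimate (\<lambda>i. Z i \<omega>) (\<lambda>i. \<delta> i \<omega>) n (\<epsilon> n)) \<longlonglongrightarrow> L0"
proof -
  have compact_G: "compact G"
    using assms(1) unfolding body_def by blast
  then have G: "G \<in> sets borel"
    by (rule borel_compact)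
  have G_cube: "G \<subseteq> unit_cube"
    using assms(2) box_subset_cbox unfolding unit_cube_def by blast
  have compact_T: "compact (frontier G)"
    using compact_G by (rule compact_frontier)
  have T_box: "frontier G \<subseteq> box 0 1"
    using assms(2) compact_G by (auto simp: frontier_def compact_imp_closed)
  then have T_cube: "frontier G \<subseteq> unit_cube"
    using box_subset_cbox unfolding unit_cube_def by blast
  obtain C e0 where C: "C > 0" "e0 > 0"
    and std: "standard_in (uniform_measure lborel G) (frontier G) C e0"
      "standard_in (uniform_measure lborel (outer G)) (frontier G) C e0"
    using assms(7) by blast
  have std_label: "standard_in (uniform_measure lborel (labelled_region G l)) (frontier G) C e0"
    if "l \<in> {0, 1}" for l
    using that std by (auto simp: labelled_region_0 labelled_region_1[OF G_cube, simplified])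
  have region: "labelled_region G l \<in> sets borel" "labelled_region G l \<subseteq> unit_cube"
    if "l \<in> {0, 1}" for l
    using that G G_cube
    by (auto simp: labelled_region_0 labelled_region_1[OF G_cube, simplified] outer_def unit_cube_def)
  have hit: "AE \<omega> in M. eventually (\<lambda>n. \<forall>t\<in>frontier G. \<exists>i\<in>{1..n}.
      \<delta> i \<omega> = l \<and> norm (Z i \<omega> - t) \<le> 1 / real (k + 2) * \<epsilon> n) sequentially"
    if l: "l \<in> {0, 1}" for l k
  proof -
    obtain \<kappa> where "\<kappa> > 0" "\<forall>t\<in>frontier G. \<forall>r. 0 < r \<and> r \<le> e0 \<longrightarrow>
        \<kappa> * r ^ CARD('d) \<le> measure lborel (labelled_region G l \<inter> cball t r)"
      using standard_in_uniform_measure_mass[OF std_label[OF l] C(1) region[OF l]] by blast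
    then show ?thesis
      using C(2) assms(8-10)
      by (intro AE_eventually_balls_hit[OF assms(5,6) G T_cube, of \<kappa> e0]) auto
  qed
  have hits: "AE \<omega> in M. \<forall>k. eventually (\<lambda>n. \<forall>l\<in>{0, 1}. \<forall>t\<in>frontier G. \<exists>i\<in>{1..n}.
      \<delta> i \<omega> = l \<and> norm (Z i \<omega> - t) \<le> 1 / real (k + 2) * \<epsilon> n) sequentially"
    unfolding AE_all_countable
  proof
    fix k
    show "AE \<omega> in M. eventually (\<lambda>n. \<forall>l\<in>{0, 1}. \<forall>t\<in>frontier G. \<exists>i\<in>{1..n}.
        \<delta> i \<omega> = l \<and> norm (Z i \<omega> - t) \<le> 1 / real (k + 2) * \<epsilon> n) sequentially"
      using hit[of 0 k, simplified] hit[of 1 k, simplified]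
      by eventually_elim (simp add: eventually_conj_iff)
  qed
  \<comment> \<open>The estimate only looks at points of the cube, so the parallel sets have to stay inside it.\<close>
  obtain e1 where e1: "e1 > 0" "(\<Union>x\<in>frontier G. cball x e1) \<subseteq> box 0 1"
    using compact_subset_open_imp_cball_epsilon_subset[OF compact_T open_box T_box] by blast
  have in_cube: "parallel_set (frontier G) e \<subseteq> unit_cube" if "e \<le> e1" for e
  proof -
    have "parallel_set (frontier G) e \<subseteq> (\<Union>x\<in>frontier G. cball x e1)"
      unfolding parallel_set_def using that by fastforce
    then show ?thesis
      using e1(2) box_subset_cbox unfolding unit_cube_def by blast
  qed
  have ev_small: "eventually (\<lambda>n. \<epsilon> n < e1) sequentially"
    using order_tendstoD(2)[OF assms(9) e1(1)] .
  show ?thesis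
    using AE_labels_truthful[OF assms(5,6) G] hits
  proof eventually_elim
    case (elim \<omega>)
    show ?case
    proof (rule content_estimate_tendsto[OF compact_T assms(3,8,9)])
      show "boundary_estimate (\<lambda>i. Z i \<omega>) (\<lambda>i. \<delta> i \<omega>) n (\<epsilon> n) \<subseteq> parallel_set (frontier G) (\<epsilon> n)" for n
        using elim(1) by (intro boundary_estimate_subset_parallel_set) auto
      show "eventually (\<lambda>n. parallel_set (frontier G) ((1 - 1 / real (k + 2)) * \<epsilon> n)
          \<subseteq> boundary_estimate (\<lambda>i. Z i \<omega>) (\<lambda>i. \<delta> i \<omega>) n (\<epsilon> n)) sequentially" for k
        using elim(2)[rule_format, of k] ev_small eventually_ge_at_top[of 1]
      proof eventually_elim
        case (elim n)
        have "(1 - 1 / real (k + 2)) * \<epsilon> n \<le> 1 * \<epsilon> n"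
          using assms(8)[of n] elim(3) by (intro mult_right_mono) auto
        then have "(1 - 1 / real (k + 2)) * \<epsilon> n \<le> e1"
          using elim(2) by linarith
        then show ?case
          using elim(1) by (intro parallel_set_subset_boundary_estimate in_cube) blast+
      qed
    qed
  qed
qed

end
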